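(* Let $0<a<b$ be real numbers, let $\alpha\in C^1([a,b],(0,1))$, fix $n\in\mathbb{N}=\{1,2,\dots\}$ and an integer $N\ge n+1$, and let $x\in C^{n+1}([a,b],\mathbb{R})$. Then for $t\in(a,b]$ the left Hadamard--Marchaud fractional derivative of variable order $\alpha(t)$ satisfies $$ {_a\mathbb{D}_t^{\alpha(t)}}x(t)=S_1(t)+E_{1,N}(t), $$ where $$ S_1(t)=\sum_{k=0}^{n}A(k)\left(\ln\frac{t}{a}\right)^{k-\alpha(t)}x_{k,0}(t)+\sum_{k=n+1}^{N}B(k)\left(\ln\frac{t}{a}\right)^{n-\alpha(t)-k}V_k(t), $$ $$ A(k)=\frac{1}{\Gamma(k+1-\alpha(t))}\left[1+\sum_{p=n-k+1}^{N}\frac{\Gamma(p+\alpha(t)-n)}{\Gamma(\alpha(t)-k)\,(p-n+k)!}\right],\quad k=0,\dots,n, $$ $$ B(k)=\frac{\Gamma(k+\alpha(t)-n)}{\Gamma(-\alpha(t))\,\Gamma(1+\alpha(t))\,(k-n)!},\quad k=n+1,\dots,N, $$ and the error $E_{1,N}(t)$ is bounded by $$ |E_{1,N}(t)|\le\max_{\tau\in[a,t]}|x_{n,1}(\tau)|\,\frac{\exp\left((n-\alpha(t))^2+n-\alpha(t)\right)}{\Gamma(n+1-\alpha(t))\,(n-\alpha(t))\,N^{n-\alpha(t)}}\left(\ln\frac{t}{a}\right)^{n-\alpha(t)}(t-a). $$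
   Context: $\Gamma$ is the Gamma function. The left Hadamard--Marchaud fractional derivative of variable order $\alpha(t)$ is $$ {_a\mathbb{D}_t^{\alpha(t)}}x(t)=\frac{x(t)}{\Gamma(1-\alpha(t))}\left(\ln\frac{t}{a}\right)^{-\alpha(t)}+\frac{\alpha(t)}{\Gamma(1-\alpha(t))}\int_a^t\frac{x(t)-x(\tau)}{\tau}\left(\ln\frac{t}{\tau}\right)^{-\alpha(t)-1}d\tau . $$ The functions $x_{k,0}$ and $x_{k,1}$ are defined recursively for $k\in\mathbb{N}\cup\{0\}$ by $$ x_{0,0}(t)=x(t),\quad x_{k+1,0}(t)=t\frac{d}{dt}x_{k,0}(t),\qquad x_{0,1}(t)=x'(t),\quad x_{k+1,1}(t)=\frac{d}{dt}\left(t\,x_{k,1}(t)\right). $$ The left moment of $x$ of order $k$ (used for $k\ge n+1$, with $n$ the fixed integer of the claim) is $$ V_k(t)=(k-n)\int_a^t\left(\ln\frac{\tau}{a}\right)^{k-n-1}\frac{x(\tau)}{\tau}\,d\tau . $$ *)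

theory Defs
  imports "HOL-Analysis.Analysis"
begin

text \<open>
  Derivatives of functions on a compact interval \<open>S = {a..b}\<close> are taken within \<open>S\<close>, so they are
  one-sided at \<open>a\<close> and \<open>b\<close>, and values of a function outside \<open>S\<close> are irrelevant.
\<close>

definition deriv_within :: "real set \<Rightarrow> (real \<Rightarrow> real) \<Rightarrow> real \<Rightarrow> real" where
  "deriv_within S f t = vector_derivative f (at t within S)"

fun Ck_on :: "nat \<Rightarrow> real set \<Rightarrow> (real \<Rightarrow> real) \<Rightarrow> bool" where
  "Ck_on 0 S f \<longleftrightarrow> continuous_on S f"
| "Ck_on (Suc k) S f \<longleftrightarrow> f differentiable_on S \<and> Ck_on k S (deriv_within S f)"

text \<open>The integrand is singular at \<open>\<tau> = t\<close>; its value there is 0 by the convention \<open>0 powr p = 0\<close>.\<close>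

definition hadamard_marchaud :: "real \<Rightarrow> (real \<Rightarrow> real) \<Rightarrow> (real \<Rightarrow> real) \<Rightarrow> real \<Rightarrow> real" where
  "hadamard_marchaud a \<alpha> x t =
     x t / Gamma (1 - \<alpha> t) * ln (t / a) powr (- \<alpha> t)
     + \<alpha> t / Gamma (1 - \<alpha> t)
       * integral {a..t} (\<lambda>\<tau>. (x t - x \<tau>) / \<tau> * ln (t / \<tau>) powr (- \<alpha> t - 1))"

fun x_seq0 :: "real set \<Rightarrow> (real \<Rightarrow> real) \<Rightarrow> nat \<Rightarrow> real \<Rightarrow> real" where
  "x_seq0 S x 0 t = x t"
| "x_seq0 S x (Suc k) t = t * deriv_within S (x_seq0 S x k) t"

fun x_seq1 :: "real set \<Rightarrow> (real \<Rightarrow> real) \<Rightarrow> nat \<Rightarrow> real \<Rightarrow> real" where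
  "x_seq1 S x 0 t = deriv_within S x t"
| "x_seq1 S x (Suc k) t = deriv_within S (\<lambda>s. s * x_seq1 S x k s) t"

text \<open>Only used for \<open>k \<ge> n + 1\<close>, where the natural-number subtractions do not truncate.\<close>

definition left_moment :: "real \<Rightarrow> nat \<Rightarrow> (real \<Rightarrow> real) \<Rightarrow> nat \<Rightarrow> real \<Rightarrow> real" where
  "left_moment a n x k t =
     real (k - n) * integral {a..t} (\<lambda>\<tau>. ln (\<tau> / a) ^ (k - n - 1) * (x \<tau> / \<tau>))"

text \<open>In the sum, \<open>p + k \<ge> n + 1\<close>, so \<open>p + k - n\<close> is the index \<open>p - n + k\<close> without truncation.\<close>

definition coeff_A :: "nat \<Rightarrow> nat \<Rightarrow> real \<Rightarrow> nat \<Rightarrow> real" where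
  "coeff_A n N \<beta> k =
     1 / Gamma (real k + 1 - \<beta>)
     * (1 + (\<Sum>p = n - k + 1..N.
               Gamma (real p + \<beta> - real n) / (Gamma (\<beta> - real k) * fact (p + k - n))))"

definition coeff_B :: "nat \<Rightarrow> real \<Rightarrow> nat \<Rightarrow> real" where
  "coeff_B n \<beta> k =
     Gamma (real k + \<beta> - real n) / (Gamma (- \<beta>) * Gamma (1 + \<beta>) * fact (k - n))"

definition S1_approx ::
  "real \<Rightarrow> real \<Rightarrow> nat \<Rightarrow> nat \<Rightarrow> (real \<Rightarrow> real) \<Rightarrow> (real \<Rightarrow> real) \<Rightarrow> real \<Rightarrow> real" where
  "S1_approx a b n N \<alpha> x t =
     (\<Sum>k = 0..n. coeff_A n N (\<alpha> t) k * ln (t / a) powr (real k - \<alpha> t) * x_seq0 {a..b} x k t)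
     + (\<Sum>k = n + 1..N. coeff_B n (\<alpha> t) k * ln (t / a) powr (real n - \<alpha> t - real k)
                         * left_moment a n x k t)"

text \<open>The maximum of \<open>\<bar>x_seq1 {a..b} x n\<bar>\<close> over the compact interval \<open>{a..t}\<close> is written as a
  supremum; the function is continuous when \<open>x\<close> is \<open>C^(n+1)\<close>.\<close>

definition error_bound ::
  "real \<Rightarrow> real \<Rightarrow> nat \<Rightarrow> nat \<Rightarrow> (real \<Rightarrow> real) \<Rightarrow> (real \<Rightarrow> real) \<Rightarrow> real \<Rightarrow> real" where
  "error_bound a b n N \<alpha> x t =
     (SUP \<tau>\<in>{a..t}. \<bar>x_seq1 {a..b} x n \<tau>\<bar>)
     * (exp ((real n - \<alpha> t)\<^sup>2 + real n - \<alpha> t)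
        / (Gamma (real n + 1 - \<alpha> t) * (real n - \<alpha> t) * real N powr (real n - \<alpha> t)))
     * ln (t / a) powr (real n - \<alpha> t) * (t - a)"

end

theory Submission
  imports Defs
begin

text \<open>
  Put \<open>u = ln (\<tau> / a)\<close>, \<open>L = ln (t / a)\<close> and \<open>q = n - \<alpha> t\<close>. In the variable \<open>u\<close> the operator
  \<open>\<tau> d/d\<tau>\<close> is \<open>d/du\<close>, and repeated integration by parts turns the derivative into a Taylor
  polynomial at \<open>a\<close> plus the integral of \<open>(L - u) powr q\<close> against \<open>x\<^bsub>n+1,0\<^esub>\<close>, up to a Gamma factor.
  Expanding \<open>(1 - u / L) powr q\<close> binomially up to degree \<open>N\<close> and integrating the monomials by parts
  gives the finite sums; the rest of the series is the error. It is at most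
  \<open>\<Sum>p>N. \<bar>q gchoose p\<bar>\<close> uniformly on \<open>[0, L]\<close>, and \<open>\<bar>q gchoose p\<bar> \<le> exp (q\<^sup>2 + q) / p powr (q + 1)\<close>.
\<close>

section \<open>Decay of generalized binomial coefficients\<close>

text \<open>By absorption, raising n by one multiplies the coefficient by (n + 1 + s) / (n + 2),
  which lies in (0, 1]; the starting value is s. It serves as the base case of
  \<open>abs_gbinomial_decay\<close>.\<close>

lemma gbinomial_Suc_bounds:
  fixes s :: real
  assumes "0 < s" "s \<le> 1"
  shows "0 \<le> (real n + s) gchoose Suc n \<and> (real n + s) gchoose Suc n \<le> s"
proof (induction n)
  case 0
  then show ?case using assms by simp
next
  case (Suc n)
  let ?g = "(real n + s) gchoose Suc n"
  have "real (Suc (Suc n)) * ((real (Suc n) + s) gchoose Suc (Suc n)) = (real (Suc n) + s) * ?g"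
    using gbinomial_absorption[of "Suc n" "real (Suc n) + s"] by simp
  then have eq: "(real (Suc n) + s) gchoose Suc (Suc n)
      = (real (Suc n) + s) / real (Suc (Suc n)) * ?g"
    by (simp add: field_simps)
  have "(real (Suc n) + s) / real (Suc (Suc n)) * ?g \<le> 1 * ?g"
    using Suc assms by (intro mult_right_mono) (auto simp: field_simps)
  then show ?case unfolding eq using Suc assms by auto
qed

lemma abs_gbinomial_Suc:
  "\<bar>q gchoose Suc p\<bar> = \<bar>q gchoose p\<bar> * (\<bar>real p - q\<bar> / real (Suc p))" for q :: real
proof -
  have "q gchoose Suc p = (q gchoose p) * (q - real p) / real (Suc p)"
    using gbinomial_absorb_comp[of q p] gbinomial_absorption[of p q]
    by (simp add: field_simps)
  then show ?thesis by (simp add: abs_mult abs_minus_commute)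
qed

text \<open>For p \<ge> n the ratio of consecutive absolute values is 1 - (q + 1) / (p + 1) \<le>
  ((p + 1) / (p + 2)) powr (q + 1), and the product of these bounds telescopes. The prefactor q - n
  + 1 is the bound at p = n.\<close>

lemma abs_gbinomial_decay:
  fixes q :: real
  assumes "real n - 1 < q" "q \<le> real n" "n \<ge> 1" "p \<ge> n"
  shows "\<bar>q gchoose p\<bar> \<le> (q - n + 1) * ((real n + 1) / (real p + 1)) powr (q + 1)"
  using assms(4)
proof (induction p rule: dec_induct)
  case base
  obtain m where m: "n = Suc m" using assms(3) by (cases n) auto
  show ?case
    using gbinomial_Suc_bounds[of "q - n + 1" m] assms by (auto simp: m)
next
  case (step p)
  have "\<bar>real p - q\<bar> / real (Suc p) = 1 + - ((q + 1) / (real p + 1))"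
    using step assms by (simp add: field_simps)
  also have "\<dots> \<le> exp (- ((q + 1) / (real p + 1)))"
    by (rule exp_ge_add_one_self)
  \<comment> \<open>From ln y \<le> y - 1 at y = (p + 2) / (p + 1); the point is to replace the
    exponential by a power whose products telescope.\<close>
  also have "\<dots> \<le> exp ((q + 1) * ln ((real p + 1) / (real p + 2)))"
  proof -
    have "ln ((real p + 2) / (real p + 1)) \<le> (real p + 2) / (real p + 1) - 1"
      by (rule ln_le_minus_one) auto
    also have "\<dots> = 1 / (real p + 1)" by (simp add: field_simps)
    finally have "- (1 / (real p + 1)) \<le> ln ((real p + 1) / (real p + 2))"
      by (simp add: ln_div)
    then have "(q + 1) * - (1 / (real p + 1)) \<le> (q + 1) * ln ((real p + 1) / (real p + 2))"
      using assms by (intro mult_left_mono) auto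
    then show ?thesis by simp
  qed
  also have "\<dots> = ((real p + 1) / (real p + 2)) powr (q + 1)"
    by (simp add: powr_def)
  finally have fac: "\<bar>real p - q\<bar> / real (Suc p) \<le> ((real p + 1) / (real p + 2)) powr (q + 1)" .
  have "\<bar>q gchoose Suc p\<bar> \<le> ((q - n + 1) * ((real n + 1) / (real p + 1)) powr (q + 1))
      * ((real p + 1) / (real p + 2)) powr (q + 1)"
    unfolding abs_gbinomial_Suc by (intro mult_mono[OF step.IH fac]) (use assms in auto)
  also have "\<dots> = (q - n + 1) * (((real n + 1) / (real p + 1)) * ((real p + 1) / (real p + 2))) powr (q + 1)"
    by (subst powr_mult) auto
  also have "((real n + 1) / (real p + 1)) * ((real p + 1) / (real p + 2)) = (real n + 1) / (real (Suc p) + 1)"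
    by simp
  finally show ?case by simp
qed

text \<open>After taking logarithms this is a polynomial inequality, using ln s \<le> s - 1 for s =
  q - n + 1 and a linear bound for ln (n + 1). The small factor s matters: for n = 1 and q near 0
  the power alone is near 2 while the right side is near 1.\<close>

lemma gbinomial_constant_le_exp:
  fixes q :: real
  assumes "real n - 1 < q" "q \<le> real n" "n \<ge> 1"
  shows "(q - n + 1) * (real n + 1) powr (q + 1) \<le> exp (q\<^sup>2 + q)"
proof -
  define s where "s = q - n + 1"
  have s: "0 < s" "s \<le> 1" and q: "q = real n - 1 + s" using assms by (auto simp: s_def)
  \<comment> \<open>The tangent to ln at 2, with 7/10 for ln 2, gives n / 2 + 1/5; the tangent at 1
    would be too weak for n = 1.\<close>
  have "ln (real n + 1) = ln 2 + ln ((real n + 1) / 2)" by (simp add: ln_div)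
  also have "\<dots> \<le> 7/10 + ((real n + 1) / 2 - 1)"
    using ln_2_less_1 ln2_le_25_over_36 ln_le_minus_one[of "(real n + 1) / 2"] by (intro add_mono) auto
  finally have "ln (real n + 1) \<le> real n / 2 + 1/5" by (simp add: field_simps)
  then have "(q + 1) * ln (real n + 1) \<le> (q + 1) * (real n / 2 + 1/5)"
    using assms by (intro mult_left_mono) auto
  moreover have "ln s \<le> s - 1" using s by (intro ln_le_minus_one) auto
  moreover have "s - 1 + (q + 1) * (real n / 2 + 1/5) \<le> q\<^sup>2 + q"
  proof -
    consider "n = 1" | "n = 2" | "n \<ge> 3" using assms by linarith
    \<comment> \<open>With q + 1 = n + s this is the difference of the two sides. For n = 1 a square
      is completed; from n = 3 on both summands are nonnegative.\<close>
    then have "(real n + s) * (real n / 2 - 6/5 + s) + 1 - s \<ge> 0"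
    proof cases
      case 1
      have "(s - 7/20)\<^sup>2 + 71/400 \<ge> 0" by simp
      then show ?thesis using 1 by (simp add: algebra_simps power2_eq_square)
    next
      case 2
      have "s\<^sup>2 + 4/5 * s + 3/5 \<ge> 0" using s by simp
      then show ?thesis using 2 by (simp add: algebra_simps power2_eq_square)
    next
      case 3
      then show ?thesis using s by (auto intro!: add_nonneg_nonneg mult_nonneg_nonneg simp: add_diff_eq[symmetric])
    qed
    then show ?thesis by (simp add: q algebra_simps add_divide_distrib power2_eq_square)
  qed
  ultimately have "ln s + (q + 1) * ln (real n + 1) \<le> q\<^sup>2 + q" by linarith
  then have "exp (ln s + (q + 1) * ln (real n + 1)) \<le> exp (q\<^sup>2 + q)" by simp
  then show ?thesis using s by (simp add: exp_add powr_def s_def add.commute)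
qed

lemma abs_gbinomial_le:
  fixes q :: real
  assumes "real n - 1 < q" "q \<le> real n" "n \<ge> 1" "p \<ge> n"
  shows "\<bar>q gchoose p\<bar> \<le> exp (q\<^sup>2 + q) * real p powr - (q + 1)"
proof -
  have p: "p \<ge> 1" using assms by simp
  have "\<bar>q gchoose p\<bar> \<le> (q - n + 1) * ((real n + 1) / (real p + 1)) powr (q + 1)"
    by (rule abs_gbinomial_decay) (use assms in auto)
  also have "\<dots> \<le> (q - n + 1) * ((real n + 1) / real p) powr (q + 1)"
    using assms p by (intro mult_left_mono powr_mono2 divide_left_mono) auto
  also have "\<dots> = ((q - n + 1) * (real n + 1) powr (q + 1)) * real p powr - (q + 1)"
    using powr_minus_divide[of "real p" "q + 1"] by (simp only: powr_divide of_nat_0_le_iff) simp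
  also have "\<dots> \<le> exp (q\<^sup>2 + q) * real p powr - (q + 1)"
    by (intro mult_right_mono gbinomial_constant_le_exp) (use assms in auto)
  finally show ?thesis .
qed

section \<open>Uniform remainder bound for the binomial series\<close>

text \<open>Discrete form of comparing with the integral of q * y powr (- q - 1) over [p, p + 1].
  The proof multiplies 1 + q / (p + 1) \<le> (p / (p + 1)) powr (- q) by (p + 1) powr (- q).\<close>

lemma powr_minus_telescope_le:
  fixes q :: real
  assumes "q > 0" "p \<ge> 1"
  shows "q * real (Suc p) powr - (q + 1) \<le> real p powr - q - real (Suc p) powr - q"
proof -
  let ?P = "real (Suc p)"
  have "1 + q / ?P \<le> exp (q / ?P)" by (rule exp_ge_add_one_self)
  also have "\<dots> \<le> exp (- q * ln (p / ?P))"
  proof -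
    have "ln (p / ?P) \<le> p / ?P - 1" using assms by (intro ln_le_minus_one) auto
    also have "\<dots> = - (1 / ?P)" by (simp add: field_simps)
    finally have "q * (1 / ?P) \<le> q * - ln (p / ?P)" using assms by (intro mult_left_mono) auto
    then show ?thesis by simp
  qed
  also have "\<dots> = (p / ?P) powr - q" using assms by (simp add: powr_def)
  finally have "(1 + q / ?P) * ?P powr - q \<le> (p / ?P) powr - q * ?P powr - q"
    by (intro mult_right_mono) auto
  also have "\<dots> = (p / ?P * ?P) powr - q" by (rule powr_mult[symmetric])
  also have "\<dots> = real p powr - q" by simp
  finally have "?P powr - q + q * (?P powr - q / ?P) \<le> real p powr - q"
    by (simp add: algebra_simps)
  moreover have eq: "?P powr - (q + 1) = ?P powr - q / ?P"
    using powr_diff[of ?P "- q" 1] by simp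
  ultimately show ?thesis unfolding eq by linarith
qed

text \<open>The subtracted \<open>real m powr - q\<close> lets the induction telescope; it is
  dropped later to get a bound independent of m.\<close>

lemma sum_abs_gbinomial_tail_le:
  fixes q :: real
  assumes "real n - 1 < q" "0 < q" "q \<le> real n" "n \<ge> 1" "N \<ge> n" "m \<ge> N"
  shows "(\<Sum>p\<in>{N<..m}. \<bar>q gchoose p\<bar>)
    \<le> exp (q\<^sup>2 + q) / q * (real N powr - q - real m powr - q)"
  using assms(6)
proof (induction m rule: dec_induct)
  case (step m)
  have "\<bar>q gchoose Suc m\<bar> \<le> exp (q\<^sup>2 + q) * real (Suc m) powr - (q + 1)"
    by (rule abs_gbinomial_le) (use assms step in auto)
  also have "\<dots> = exp (q\<^sup>2 + q) / q * (q * real (Suc m) powr - (q + 1))"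
    using assms by simp
  also have "\<dots> \<le> exp (q\<^sup>2 + q) / q * (real m powr - q - real (Suc m) powr - q)"
    by (intro mult_left_mono powr_minus_telescope_le) (use assms step in auto)
  finally have "\<bar>q gchoose Suc m\<bar> \<le> \<dots>" .
  moreover have "{N<..Suc m} = insert (Suc m) {N<..m}" using step by auto
  ultimately show ?case using step by (simp add: algebra_simps)
qed auto

text \<open>Since s ^ p \<le> 1, partial sums beyond N differ from the one at N by at most a tail of
  absolute coefficients, uniformly in s. The bound survives the limit.\<close>

lemma binomial_series_remainder_le:
  fixes q s :: real
  assumes "real n - 1 < q" "0 < q" "q \<le> real n" "n \<ge> 1" "N \<ge> n" "0 \<le> s" "s < 1"
  shows "\<bar>(1 - s) powr q - (\<Sum>p\<le>N. (q gchoose p) * (- s) ^ p)\<bar>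
    \<le> exp (q\<^sup>2 + q) / (q * real N powr q)"
proof -
  let ?f = "\<lambda>p. (q gchoose p) * (- s) ^ p"
  have "?f sums (1 + - s) powr q"
    by (rule gen_binomial_real) (use assms in auto)
  then have "(\<lambda>m. sum ?f {..m}) \<longlonglongrightarrow> (1 - s) powr q"
    by (simp add: sums_def_le)
  then have "(\<lambda>m. \<bar>sum ?f {..m} - sum ?f {..N}\<bar>) \<longlonglongrightarrow> \<bar>(1 - s) powr q - sum ?f {..N}\<bar>"
    by (intro tendsto_intros)
  moreover have "\<bar>sum ?f {..m} - sum ?f {..N}\<bar> \<le> exp (q\<^sup>2 + q) / (q * real N powr q)"
    if "m \<ge> N" for m
  proof -
    have "{..m} - {..N} = {N<..m}" by auto
    then have "sum ?f {..m} - sum ?f {..N} = sum ?f {N<..m}"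
      using that by (subst sum_diff[symmetric]) auto
    then have "\<bar>sum ?f {..m} - sum ?f {..N}\<bar> \<le> (\<Sum>p\<in>{N<..m}. \<bar>?f p\<bar>)"
      by (simp add: sum_abs)
    also have "\<dots> \<le> (\<Sum>p\<in>{N<..m}. \<bar>q gchoose p\<bar>)"
      using assms by (intro sum_mono) (auto simp: abs_mult power_abs intro!: mult_right_le_one_le power_le_one)
    also have "\<dots> \<le> exp (q\<^sup>2 + q) / q * (real N powr - q - real m powr - q)"
      by (rule sum_abs_gbinomial_tail_le) (use assms that in auto)
    also have "\<dots> \<le> exp (q\<^sup>2 + q) / q * real N powr - q"
      using assms by (intro mult_left_mono) auto
    also have "\<dots> = exp (q\<^sup>2 + q) / (q * real N powr q)"
      by (simp add: powr_minus_divide)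
    finally show ?thesis .
  qed
  ultimately show ?thesis
    by (intro tendsto_upperbound[of _ _ sequentially]) (auto simp: eventually_sequentially)
qed

text \<open>The point s = 1, which is the endpoint \<tau> = t in the application, is reached by
  continuity because q > 0; convergence of the series was used only for s < 1.\<close>

lemma binomial_series_remainder_le_Icc:
  fixes q s :: real
  assumes "real n - 1 < q" "0 < q" "q \<le> real n" "n \<ge> 1" "N \<ge> n" "s \<in> {0..1}"
  shows "\<bar>(1 - s) powr q - (\<Sum>p\<le>N. (q gchoose p) * (- s) ^ p)\<bar>
    \<le> exp (q\<^sup>2 + q) / (q * real N powr q)"
proof (rule continuous_le_on_closure[of "{0..<1}"
      "\<lambda>s. \<bar>(1 - s) powr q - (\<Sum>p\<le>N. (q gchoose p) * (- s) ^ p)\<bar>" s])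
  have cl: "closure {0..<1} = {0..1::real}" by simp
  show "continuous_on (closure {0..<1}) (\<lambda>s. \<bar>(1 - s) powr q - (\<Sum>p\<le>N. (q gchoose p) * (- s) ^ p)\<bar>)"
    unfolding cl using assms by (intro continuous_intros continuous_on_powr') auto
  show "s \<in> closure {0..<1}" unfolding cl by (rule assms)
qed (use binomial_series_remainder_le assms in auto)

section \<open>Derivatives within the interval and regularity of the iterated derivatives\<close>

lemma deriv_within_unique:
  fixes f :: "real \<Rightarrow> real"
  assumes "(f has_real_derivative D) (at t within {a..b})" "a < b" "t \<in> {a..b}"
  shows "deriv_within {a..b} f t = D"
proof -
  have "(f has_vector_derivative D) (at t within cbox a b)"
    using assms by (simp add: has_real_derivative_iff_has_vector_derivative)
  then show ?thesis
    unfolding deriv_within_def using assms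
    by (metis vector_derivative_within_cbox box_real(2))
qed

lemma has_real_derivative_deriv_within:
  fixes f :: "real \<Rightarrow> real"
  assumes "f differentiable_on {a..b}" "a < b" "t \<in> {a..b}"
  shows "(f has_real_derivative deriv_within {a..b} f t) (at t within {a..b})"
proof -
  obtain D where "(f has_real_derivative D) (at t within {a..b})"
    using assms unfolding differentiable_on_def real_differentiable_def by blast
  with deriv_within_unique[OF this assms(2,3)] show ?thesis by simp
qed

lemma deriv_within_cong:
  assumes "\<And>s. s \<in> {a..b} \<Longrightarrow> f s = g s" "t \<in> {a..b}"
  shows "deriv_within {a..b} f t = deriv_within {a..b} g t"
proof -
  have "(f has_vector_derivative D) (at t within {a..b})
      \<longleftrightarrow> (g has_vector_derivative D) (at t within {a..b})" for D
    by (rule iffI; erule has_vector_derivative_transform[OF assms(2), rotated]) (simp_all add: assms(1))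
  then show ?thesis unfolding deriv_within_def vector_derivative_def by simp
qed

text \<open>Needed because formulas for \<open>deriv_within\<close> hold only on the interval,
  whereas \<open>Ck_on\<close> takes functions on the whole line.\<close>

lemma Ck_on_cong:
  assumes "\<And>s. s \<in> {a..b} \<Longrightarrow> f s = g s" "Ck_on k {a..b} f"
  shows "Ck_on k {a..b} g"
  using assms
proof (induction k arbitrary: f g)
  case 0
  then show ?case using continuous_on_cong by (metis Ck_on.simps(1))
next
  case (Suc k)
  have "g differentiable at t within {a..b}" if "t \<in> {a..b}" for t
    using differentiable_transform_within[of f t "{a..b}" 1 g] Suc.prems that
    by (simp add: differentiable_on_def)
  then have "g differentiable_on {a..b}"
    unfolding differentiable_on_def by blast
  moreover have "Ck_on k {a..b} (deriv_within {a..b} g)"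
  proof (rule Suc.IH)
    show "Ck_on k {a..b} (deriv_within {a..b} f)" using Suc.prems by simp
    show "deriv_within {a..b} f s = deriv_within {a..b} g s" if "s \<in> {a..b}" for s
      by (rule deriv_within_cong[OF Suc.prems(1) that])
  qed
  ultimately show ?case by simp
qed

lemma Ck_on_SucD: "Ck_on (Suc k) S f \<Longrightarrow> Ck_on k S f"
proof (induction k arbitrary: f)
  case 0
  then show ?case by (simp add: differentiable_imp_continuous_on)
qed auto

lemma Ck_on_add:
  assumes "a < b" "Ck_on k {a..b} f" "Ck_on k {a..b} g"
  shows "Ck_on k {a..b} (\<lambda>s. f s + g s)"
  using assms(2,3)
proof (induction k arbitrary: f g)
  case 0
  then show ?case by (auto intro: continuous_intros)
next
  case (Suc k)
  have eq: "deriv_within {a..b} (\<lambda>s. f s + g s) t = deriv_within {a..b} f t + deriv_within {a..b} g t"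
    if "t \<in> {a..b}" for t
    using that assms(1) Suc.prems
    by (intro deriv_within_unique DERIV_add has_real_derivative_deriv_within) auto
  have "Ck_on k {a..b} (\<lambda>t. deriv_within {a..b} f t + deriv_within {a..b} g t)"
    using Suc by auto
  then have "Ck_on k {a..b} (deriv_within {a..b} (\<lambda>s. f s + g s))"
    by (rule Ck_on_cong[rotated]) (rule eq[symmetric])
  then show ?case using Suc.prems by (auto intro: differentiable_on_add)
qed

lemma Ck_on_times_id:
  assumes "a < b" "Ck_on k {a..b} f"
  shows "Ck_on k {a..b} (\<lambda>s. s * f s)"
  using assms(2)
proof (induction k arbitrary: f)
  case 0
  then show ?case by (auto intro: continuous_intros)
next
  case (Suc k)
  have der: "((\<lambda>s. s * f s) has_real_derivative f t + t * deriv_within {a..b} f t)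
      (at t within {a..b})" if "t \<in> {a..b}" for t
    using that assms(1) Suc.prems
    by (auto intro!: derivative_eq_intros has_real_derivative_deriv_within)
  have "Ck_on k {a..b} (\<lambda>t. f t + t * deriv_within {a..b} f t)"
    by (rule Ck_on_add[OF assms(1) Ck_on_SucD]) (use Suc in auto)
  then have "Ck_on k {a..b} (deriv_within {a..b} (\<lambda>s. s * f s))"
    by (rule Ck_on_cong[rotated]) (auto simp: deriv_within_unique[OF der] assms)
  moreover have "(\<lambda>s. s * f s) differentiable_on {a..b}"
    unfolding differentiable_on_def real_differentiable_def using der by blast
  ultimately show ?case by simp
qed

text \<open>Each step of \<open>x_seq0\<close> spends one derivative, and the factor t costs none.
  The induction therefore uses its hypothesis at \<open>Suc m\<close>.\<close>

lemma Ck_on_x_seq0: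
  assumes "a < b" "Ck_on (k + m) {a..b} x"
  shows "Ck_on m {a..b} (x_seq0 {a..b} x k)"
  using assms(2)
proof (induction k arbitrary: m)
  case 0
  then show ?case by (simp add: x_seq0.simps(1)[abs_def])
next
  case (Suc k)
  then have "Ck_on (Suc m) {a..b} (x_seq0 {a..b} x k)"
    using Suc.IH[of "Suc m"] Suc.prems by (simp only: add_Suc add_Suc_right)
  then have "Ck_on m {a..b} (\<lambda>t. t * deriv_within {a..b} (x_seq0 {a..b} x k) t)"
    by (intro Ck_on_times_id assms) auto
  then show ?case by (rule Ck_on_cong[rotated]) simp
qed

lemma x_seq0_has_real_derivative:
  assumes "0 < a" "a < b" "Ck_on (Suc k) {a..b} x" "t \<in> {a..b}"
  shows "(x_seq0 {a..b} x k has_real_derivative x_seq0 {a..b} x (Suc k) t / t)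
    (at t within {a..b})"
proof -
  have "x_seq0 {a..b} x k differentiable_on {a..b}"
    using Ck_on_x_seq0[of a b k "Suc 0" x] assms by simp
  then show ?thesis
    using has_real_derivative_deriv_within[of "x_seq0 {a..b} x k" a b t] assms by simp
qed

lemma continuous_on_x_seq0:
  assumes "a < b" "Ck_on k {a..b} x"
  shows "continuous_on {a..b} (x_seq0 {a..b} x k)"
  using Ck_on_x_seq0[of a b k 0 x] assms by simp

text \<open>Both recursions alternate d/dt and multiplication by t, offset by one multiplication.
  This turns the quotient in the remainder integral into the function of the error bound.\<close>

lemma x_seq1_eq_x_seq0:
  assumes "0 < a" "t \<in> {a..b}"
  shows "x_seq1 {a..b} x k t = x_seq0 {a..b} x (Suc k) t / t"
  using assms(2)
proof (induction k arbitrary: t)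
  case 0
  then show ?case using assms by (simp add: x_seq0.simps(1)[abs_def])
next
  case (Suc k)
  have "deriv_within {a..b} (\<lambda>s. s * x_seq1 {a..b} x k s) t
      = deriv_within {a..b} (x_seq0 {a..b} x (Suc k)) t"
    using Suc assms by (intro deriv_within_cong) auto
  then show ?case using Suc.prems assms by simp
qed

section \<open>Integral Taylor formula for the Hadamard-Marchaud derivative\<close>

lemma has_real_derivative_ln_ratio_powr:
  fixes t \<tau> r :: real
  assumes "0 < \<tau>" "\<tau> < t"
  shows "((\<lambda>\<tau>. ln (t / \<tau>) powr r) has_real_derivative - (r * ln (t / \<tau>) powr (r - 1) / \<tau>)) (at \<tau>)"
proof -
  have "((\<lambda>\<tau>. ln (t / \<tau>)) has_real_derivative - (1 / \<tau>)) (at \<tau>)"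
    using assms by (auto intro!: derivative_eq_intros simp: field_simps power2_eq_square)
  from DERIV_chain2[OF has_real_derivative_powr this, of r] show ?thesis
    using assms by simp
qed

lemma Gamma_Suc_shift:
  fixes \<beta> :: real
  assumes "0 < \<beta>" "\<beta> < 1"
  shows "Gamma (real (Suc k) + 1 - \<beta>) = (real (Suc k) - \<beta>) * Gamma (real k + 1 - \<beta>)"
proof -
  have "real k + 1 - \<beta> > 0" using assms by simp
  then have "real k + 1 - \<beta> \<notin> \<int>\<^sub>\<le>\<^sub>0" by auto
  from Gamma_plus1[OF this] show ?thesis by (simp add: algebra_simps)
qed

text \<open>Only \<tau> = t is critical, where the power of the logarithm blows up for positive
  \<beta>. The increment is Lipschitz and t - \<tau> \<le> t * ln (t / \<tau>), so the product is
  dominated by a multiple of ln (t / \<tau>) powr (1 - \<beta>), which tends to 0 since \<beta> <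
  1.\<close>

lemma continuous_on_powr_increment:
  fixes f f' :: "real \<Rightarrow> real"
  assumes "0 < a" "a < t" "\<beta> < 1"
    and der: "\<And>\<tau>. \<tau> \<in> {a..t} \<Longrightarrow> (f has_real_derivative f' \<tau>) (at \<tau> within {a..t})"
    and cont: "continuous_on {a..t} f'"
  shows "continuous_on {a..t} (\<lambda>\<tau>. (f t - f \<tau>) * ln (t / \<tau>) powr (- \<beta>))"
  unfolding continuous_on_def
proof
  fix \<tau> assume \<tau>: "\<tau> \<in> {a..t}"
  have lim: "(f \<longlongrightarrow> f \<tau>) (at \<tau> within {a..t})"
    using der[OF \<tau>] DERIV_continuous continuous_within by blast
  show "((\<lambda>\<tau>. (f t - f \<tau>) * ln (t / \<tau>) powr (- \<beta>)) \<longlongrightarrow> (f t - f \<tau>) * ln (t / \<tau>) powr (- \<beta>))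
      (at \<tau> within {a..t})"
  proof (cases "\<tau> = t")
    case False
    then have "ln (t / \<tau>) \<noteq> 0" "t / \<tau> \<noteq> 0" "\<tau> \<noteq> 0" using \<tau> assms by auto
    then show ?thesis
      by (intro tendsto_intros lim) auto
  next
    case True
    obtain B where "\<forall>y \<in> f' ` {a..t}. norm y \<le> B"
      using compact_imp_bounded[OF compact_continuous_image[OF cont compact_Icc]]
      unfolding bounded_iff by blast
    then have B: "\<And>\<sigma>. \<sigma> \<in> {a..t} \<Longrightarrow> \<bar>f' \<sigma>\<bar> \<le> B" by auto
    have lip: "\<bar>f t - f \<sigma>\<bar> \<le> B * (t - \<sigma>)" if "\<sigma> \<in> {a..t}" for \<sigma>
      using field_differentiable_bound[OF convex_real_interval(5) der, of B t \<sigma>] B that assms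
      by auto
    have "continuous_on {a..t} (\<lambda>\<sigma>. B * t * ln (t / \<sigma>) powr (1 - \<beta>))"
      using assms by (intro continuous_intros continuous_on_powr') auto
    from bspec[OF this[unfolded continuous_on_def], of t]
    have "((\<lambda>\<sigma>. B * t * ln (t / \<sigma>) powr (1 - \<beta>)) \<longlongrightarrow> 0) (at t within {a..t})"
      using assms by simp
    moreover have "\<forall>\<^sub>F \<sigma> in at t within {a..t}.
        norm ((f t - f \<sigma>) * ln (t / \<sigma>) powr (- \<beta>)) \<le> B * t * ln (t / \<sigma>) powr (1 - \<beta>)"
      unfolding eventually_at_filter
    proof (intro always_eventually allI impI)
      fix \<sigma> assume \<sigma>: "\<sigma> \<noteq> t" "\<sigma> \<in> {a..t}"
      have pos: "ln (t / \<sigma>) > 0" using \<sigma> assms by auto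
      have "ln (\<sigma> / t) \<le> \<sigma> / t - 1" using \<sigma> assms by (intro ln_le_minus_one) auto
      then have "t * (1 - \<sigma> / t) \<le> t * ln (t / \<sigma>)"
        using \<sigma> assms by (intro mult_left_mono) (auto simp: ln_div)
      then have "t - \<sigma> \<le> t * ln (t / \<sigma>)"
        using assms by (simp add: algebra_simps)
      moreover have "0 \<le> B" using B[of t] assms by force
      ultimately have "\<bar>f t - f \<sigma>\<bar> \<le> B * (t * ln (t / \<sigma>))"
        using lip[OF \<sigma>(2)] mult_left_mono order_trans by blast
      then have "\<bar>f t - f \<sigma>\<bar> * ln (t / \<sigma>) powr (- \<beta>) \<le> B * (t * ln (t / \<sigma>)) * ln (t / \<sigma>) powr (- \<beta>)"
        by (intro mult_right_mono) auto
      also have "\<dots> = B * t * ln (t / \<sigma>) powr (1 - \<beta>)"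
        using pos by (simp add: powr_diff powr_minus_divide)
      finally show "norm ((f t - f \<sigma>) * ln (t / \<sigma>) powr (- \<beta>)) \<le> B * t * ln (t / \<sigma>) powr (1 - \<beta>)"
        by (simp add: abs_mult)
    qed
    ultimately have "((\<lambda>\<sigma>. (f t - f \<sigma>) * ln (t / \<sigma>) powr (- \<beta>)) \<longlongrightarrow> 0) (at t within {a..t})"
      by (rule Lim_null_comparison[rotated])
    then show ?thesis using True by simp
  qed
qed

text \<open>Integrating by parts with \<open>l \<tau> powr (- \<beta>)\<close>, whose derivative is
  \<beta> times the singular kernel, removes the singularity; the boundary term at a exchanges the
  value at t for the value at a. A further n integrations raise the power of the logarithm to n -
  \<beta>.\<close>

lemma hadamard_marchaud_taylor:
  fixes X :: "nat \<Rightarrow> real \<Rightarrow> real"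
  assumes "0 < a" "a < t" "0 < \<alpha> t" "\<alpha> t < 1" "n \<ge> 1"
    and der: "\<And>k \<tau>. k \<le> n \<Longrightarrow> \<tau> \<in> {a..t} \<Longrightarrow>
      (X k has_real_derivative X (Suc k) \<tau> / \<tau>) (at \<tau> within {a..t})"
    and cont: "continuous_on {a..t} (X (Suc n))"
  shows "hadamard_marchaud a \<alpha> (X 0) t =
    (\<Sum>k\<le>n. X k a * ln (t / a) powr (real k - \<alpha> t) / Gamma (real k + 1 - \<alpha> t))
    + 1 / Gamma (real n + 1 - \<alpha> t)
      * integral {a..t} (\<lambda>\<tau>. ln (t / \<tau>) powr (real n - \<alpha> t) * (X (Suc n) \<tau> / \<tau>))"
proof -
  define \<beta> where "\<beta> = \<alpha> t"
  have \<beta>: "0 < \<beta>" "\<beta> < 1" using assms by (auto simp: \<beta>_def)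
  define l where "l = (\<lambda>\<tau>. ln (t / \<tau>))"
  \<comment> \<open>Normalised so that \<open>c 0 = 1\<close> and differentiating the power with
    exponent \<open>real (Suc k) - \<beta>\<close> turns \<open>c (Suc k)\<close> into
    \<open>c k\<close>.\<close>
  define c where "c = (\<lambda>k. Gamma (1 - \<beta>) / Gamma (real k + 1 - \<beta>))"
  define h where "h = (\<lambda>k \<tau>. c k * (l \<tau> powr (real k - \<beta>) * (X (Suc k) \<tau> / \<tau>)))"
  define g where "g = (\<lambda>\<tau>. (X 0 t - X 0 \<tau>) / \<tau> * l \<tau> powr (- \<beta> - 1))"
  \<comment> \<open>\<open>F\<close> collects the boundary terms of all the integrations by parts, so its derivative telescopes
    to the singular integrand minus the Taylor remainder integrand.\<close>
  define F where "F = (\<lambda>\<tau>. (X 0 t - X 0 \<tau>) * l \<tau> powr (- \<beta>)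
    - (\<Sum>k<n. c (Suc k) * X (Suc k) \<tau> * l \<tau> powr (real (Suc k) - \<beta>)))"
  have Gpos: "Gamma (real k + 1 - \<beta>) > 0" for k
    using \<beta> by (intro Gamma_real_pos) simp
  have c0: "c 0 = 1" using Gpos[of 0] by (simp add: c_def)
  have cSuc: "c (Suc k) * (real (Suc k) - \<beta>) = c k" for k
    using \<beta> Gpos[of k] unfolding c_def Gamma_Suc_shift[OF \<beta>]
    by (simp add: divide_simps)
  have contX: "continuous_on {a..t} (X k)" if "k \<le> Suc n" for k
  proof (cases "k = Suc n")
    case False
    then show ?thesis
      using der[of k] that by (intro DERIV_continuous_on[of _ _ "\<lambda>\<tau>. X (Suc k) \<tau> / \<tau>"]) auto
  qed (use cont in simp)
  have contp: "continuous_on {a..t} (\<lambda>\<tau>. l \<tau> powr r)" if "r > 0" for r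
    unfolding l_def using assms that by (intro continuous_intros continuous_on_powr') auto
  have conth: "continuous_on {a..t} (h n)"
    unfolding h_def using assms \<beta> by (intro continuous_intros contp cont) auto
  have "continuous_on {a..t} F"
    unfolding F_def
  proof (rule continuous_on_diff)
    show "continuous_on {a..t} (\<lambda>\<tau>. (X 0 t - X 0 \<tau>) * l \<tau> powr (- \<beta>))"
      unfolding l_def
      using assms \<beta>
      by (intro continuous_on_powr_increment[where f' = "\<lambda>\<tau>. X (Suc 0) \<tau> / \<tau>"]
          continuous_intros contX der) auto
    show "continuous_on {a..t} (\<lambda>\<tau>. \<Sum>k<n. c (Suc k) * X (Suc k) \<tau> * l \<tau> powr (real (Suc k) - \<beta>))"
      using \<beta> by (intro continuous_on_sum continuous_intros contX contp) auto
  qed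
  moreover have "(F has_vector_derivative \<beta> * g \<tau> - h n \<tau>) (at \<tau>)" if \<tau>: "\<tau> \<in> {a<..<t}" for \<tau>
  proof -
    have dX: "(X k has_real_derivative X (Suc k) \<tau> / \<tau>) (at \<tau>)" if "k \<le> n" for k
      using der[OF that, of \<tau>] \<tau> at_within_Icc_at[of a \<tau> t] by auto
    have dl: "((\<lambda>\<tau>. l \<tau> powr r) has_real_derivative - (r * l \<tau> powr (r - 1) / \<tau>)) (at \<tau>)" for r
      unfolding l_def using \<tau> assms by (intro has_real_derivative_ln_ratio_powr) auto
    have 1: "((\<lambda>\<tau>. (X 0 t - X 0 \<tau>) * l \<tau> powr (- \<beta>)) has_real_derivative
        \<beta> * g \<tau> - h 0 \<tau>) (at \<tau>)"
      using DERIV_mult'[OF DERIV_diff[OF DERIV_const dX[of 0]] dl[of "- \<beta>"], of "X 0 t"]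
      by (simp add: g_def h_def c0 algebra_simps)
    have 2: "((\<lambda>\<tau>. c (Suc k) * X (Suc k) \<tau> * l \<tau> powr (real (Suc k) - \<beta>)) has_real_derivative
        h (Suc k) \<tau> - h k \<tau>) (at \<tau>)" if "k < n" for k
    proof -
      have "((\<lambda>\<tau>. c (Suc k) * (X (Suc k) \<tau> * l \<tau> powr (real (Suc k) - \<beta>))) has_real_derivative
          c (Suc k) * (X (Suc k) \<tau> * - ((real (Suc k) - \<beta>) * l \<tau> powr (real (Suc k) - \<beta> - 1) / \<tau>)
            + X (Suc (Suc k)) \<tau> / \<tau> * l \<tau> powr (real (Suc k) - \<beta>))) (at \<tau>)"
        by (intro DERIV_cmult DERIV_mult' dX dl) (use that in simp)
      also have "c (Suc k) * (X (Suc k) \<tau> * - ((real (Suc k) - \<beta>) * l \<tau> powr (real (Suc k) - \<beta> - 1) / \<tau>)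
            + X (Suc (Suc k)) \<tau> / \<tau> * l \<tau> powr (real (Suc k) - \<beta>))
          = h (Suc k) \<tau> - (c (Suc k) * (real (Suc k) - \<beta>)) * (l \<tau> powr (real k - \<beta>) * (X (Suc k) \<tau> / \<tau>))"
        by (simp add: h_def algebra_simps add_divide_distrib diff_divide_distrib)
      finally show ?thesis unfolding cSuc by (simp add: h_def mult.assoc)
    qed
    have "(F has_real_derivative \<beta> * g \<tau> - h 0 \<tau> - (\<Sum>k<n. h (Suc k) \<tau> - h k \<tau>)) (at \<tau>)"
      unfolding F_def by (intro DERIV_diff 1 DERIV_sum 2) auto
    also have "(\<Sum>k<n. h (Suc k) \<tau> - h k \<tau>) = h n \<tau> - h 0 \<tau>"
      by (rule sum_lessThan_telescope)
    finally show ?thesis by (simp add: has_real_derivative_iff_has_vector_derivative)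
  qed
  \<comment> \<open>The interior form asks for continuity of \<open>F\<close> up to t but
    differentiability only inside, so it also yields integrability of the singular
    \<open>g\<close>.\<close>
  ultimately have "((\<lambda>\<tau>. \<beta> * g \<tau> - h n \<tau>) has_integral F t - F a) {a..t}"
    using assms by (intro fundamental_theorem_of_calculus_interior) auto
  from has_integral_add[OF this integrable_integral[OF integrable_continuous_interval[OF conth]]]
  have "((\<lambda>\<tau>. \<beta> * g \<tau>) has_integral F t - F a + integral {a..t} (h n)) {a..t}"
    by simp
  from integral_unique[OF this]
  have "integral {a..t} (\<lambda>\<tau>. \<beta> * g \<tau>) = F t - F a + integral {a..t} (h n)" .
  \<comment> \<open>At t the increment vanishes and the remaining powers have base
    \<open>l t = 0\<close>, so only the boundary at a survives.\<close>
  moreover have "F t = 0" using assms by (simp add: F_def l_def)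
  ultimately have int: "\<beta> * integral {a..t} g = integral {a..t} (h n) - F a"
    by simp
  have inth: "integral {a..t} (h n)
      = c n * integral {a..t} (\<lambda>\<tau>. l \<tau> powr (real n - \<beta>) * (X (Suc n) \<tau> / \<tau>))"
    unfolding h_def by (rule integral_mult_right)
  have "hadamard_marchaud a \<alpha> (X 0) t
      = (X 0 t * l a powr (- \<beta>) + \<beta> * integral {a..t} g) / Gamma (1 - \<beta>)"
    unfolding hadamard_marchaud_def \<beta>_def g_def l_def by (simp add: add_divide_distrib)
  also have "\<dots> = (X 0 a * l a powr (- \<beta>) + (\<Sum>k<n. c (Suc k) * X (Suc k) a * l a powr (real (Suc k) - \<beta>)))
      / Gamma (1 - \<beta>) + integral {a..t} (h n) / Gamma (1 - \<beta>)"
    unfolding int F_def by (simp add: algebra_simps add_divide_distrib diff_divide_distrib)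
  also have "integral {a..t} (h n) / Gamma (1 - \<beta>) = 1 / Gamma (real n + 1 - \<beta>)
      * integral {a..t} (\<lambda>\<tau>. l \<tau> powr (real n - \<beta>) * (X (Suc n) \<tau> / \<tau>))"
    unfolding inth using Gpos[of 0] by (simp add: c_def)
  also have "(X 0 a * l a powr (- \<beta>) + (\<Sum>k<n. c (Suc k) * X (Suc k) a * l a powr (real (Suc k) - \<beta>)))
      / Gamma (1 - \<beta>) = (\<Sum>k\<le>n. X k a * l a powr (real k - \<beta>) / Gamma (real k + 1 - \<beta>))"
    unfolding sum.atMost_shift using Gpos[of 0]
    by (simp add: add_divide_distrib sum_divide_distrib c_def)
  finally show ?thesis unfolding \<beta>_def l_def .
qed

section \<open>Logarithmic moments and the coefficients A and B\<close>

text \<open>The boundary term at a survives only in degree 0, because ln (a / a) = 0; in the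
  expansion it cancels the Taylor terms at a.\<close>

lemma log_moment_by_parts:
  fixes f g :: "real \<Rightarrow> real"
  assumes "0 < a" "a < t"
    and der: "\<And>\<tau>. \<tau> \<in> {a..t} \<Longrightarrow> (f has_real_derivative g \<tau> / \<tau>) (at \<tau> within {a..t})"
    and cont: "continuous_on {a..t} f"
  shows "integral {a..t} (\<lambda>\<tau>. ln (\<tau> / a) ^ 0 * (g \<tau> / \<tau>)) = f t - f a"
    and "integral {a..t} (\<lambda>\<tau>. ln (\<tau> / a) ^ Suc p * (g \<tau> / \<tau>))
      = ln (t / a) ^ Suc p * f t - real (Suc p) * integral {a..t} (\<lambda>\<tau>. ln (\<tau> / a) ^ p * (f \<tau> / \<tau>))"
proof -
  have "((\<lambda>\<tau>. g \<tau> / \<tau>) has_integral f t - f a) {a..t}"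
    using assms by (intro fundamental_theorem_of_calculus)
      (auto simp: has_real_derivative_iff_has_vector_derivative[symmetric])
  then show "integral {a..t} (\<lambda>\<tau>. ln (\<tau> / a) ^ 0 * (g \<tau> / \<tau>)) = f t - f a"
    by (simp add: integral_unique)
  let ?h = "\<lambda>\<tau>. real (Suc p) * (ln (\<tau> / a) ^ p * (f \<tau> / \<tau>))"
  have "((\<lambda>\<tau>. ln (\<tau> / a) ^ Suc p * f \<tau>) has_real_derivative
      ?h \<tau> + ln (\<tau> / a) ^ Suc p * (g \<tau> / \<tau>)) (at \<tau> within {a..t})" if \<tau>: "\<tau> \<in> {a..t}" for \<tau>
  proof -
    have "((\<lambda>\<tau>. ln (\<tau> / a)) has_real_derivative 1 / \<tau>) (at \<tau> within {a..t})"
      using \<tau> assms by (auto intro!: derivative_eq_intros simp: field_simps)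
    from DERIV_mult'[OF DERIV_power[OF this, of "Suc p"] der[OF \<tau>]]
    show ?thesis by (simp add: algebra_simps)
  qed
  then have "((\<lambda>\<tau>. ?h \<tau> + ln (\<tau> / a) ^ Suc p * (g \<tau> / \<tau>)) has_integral
      ln (t / a) ^ Suc p * f t - ln (a / a) ^ Suc p * f a) {a..t}"
    using assms by (intro fundamental_theorem_of_calculus)
      (auto simp: has_real_derivative_iff_has_vector_derivative[symmetric])
  \<comment> \<open>\<open>g\<close> is not assumed continuous, so its integral is reached by
    subtracting the integrable \<open>?h\<close> from the total derivative.\<close>
  moreover have "?h integrable_on {a..t}"
    using assms by (intro integrable_continuous_interval continuous_intros) auto
  ultimately have "((\<lambda>\<tau>. ?h \<tau> + ln (\<tau> / a) ^ Suc p * (g \<tau> / \<tau>) - ?h \<tau>) has_integral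
      ln (t / a) ^ Suc p * f t - ln (a / a) ^ Suc p * f a - integral {a..t} ?h) {a..t}"
    by (intro has_integral_diff integrable_integral)
  then have "((\<lambda>\<tau>. ln (\<tau> / a) ^ Suc p * (g \<tau> / \<tau>)) has_integral
      ln (t / a) ^ Suc p * f t - integral {a..t} ?h) {a..t}"
    using assms(1) by (simp only: add_diff_cancel_left') simp
  moreover have "integral {a..t} ?h
      = real (Suc p) * integral {a..t} (\<lambda>\<tau>. ln (\<tau> / a) ^ p * (f \<tau> / \<tau>))"
    by (rule integral_mult_right)
  ultimately show "integral {a..t} (\<lambda>\<tau>. ln (\<tau> / a) ^ Suc p * (g \<tau> / \<tau>))
      = ln (t / a) ^ Suc p * f t - real (Suc p) * integral {a..t} (\<lambda>\<tau>. ln (\<tau> / a) ^ p * (f \<tau> / \<tau>))"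
    by (simp only: integral_unique)
qed

lemma fraction_minus_nat_notin_Ints:
  fixes \<beta> :: real
  assumes "0 < \<beta>" "\<beta> < 1"
  shows "\<beta> - real k \<notin> \<int>"
proof
  assume "\<beta> - real k \<in> \<int>"
  then have "\<beta> - real k + real k \<in> \<int>" by (intro Ints_add Ints_of_nat)
  then obtain i :: int where "\<beta> = of_int i" by (auto simp: Ints_def)
  then show False using assms by simp
qed

lemma Gamma_shift_ratio:
  fixes \<beta> :: real
  assumes "0 < \<beta>" "\<beta> < 1"
  shows "Gamma (\<beta> - real k + real j) / Gamma (\<beta> - real k) = pochhammer (\<beta> - real k) j"
proof -
  have "\<beta> - real k \<notin> \<int>\<^sub>\<le>\<^sub>0"
    using fraction_minus_nat_notin_Ints[OF assms] nonpos_Ints_Int by blast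
  then show ?thesis by (simp add: pochhammer_Gamma)
qed

text \<open>Substituting j = p + k - n turns the Gamma quotients into pochhammer symbols, and the
  leading 1 of \<open>coeff_A\<close> becomes the term j = 0. Writing N as M + n gives the upper
  limit M + k.\<close>

lemma coeff_A_eq:
  assumes "0 < \<beta>" "\<beta> < 1" "k \<le> n"
  shows "coeff_A n (M + n) \<beta> k
    = (\<Sum>j\<le>M + k. pochhammer (\<beta> - real k) j / fact j) / Gamma (real k + 1 - \<beta>)"
proof -
  have "(\<Sum>p = n - k + 1..M + n. Gamma (real p + \<beta> - real n) / (Gamma (\<beta> - real k) * fact (p + k - n)))
      = (\<Sum>j<M + k. pochhammer (\<beta> - real k) (Suc j) / fact (Suc j))"
  proof (rule sum.reindex_bij_witness[where i = "\<lambda>j. j + 1 + n - k" and j = "\<lambda>p. p + k - n - 1"])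
    fix p assume p: "p \<in> {n - k + 1..M + n}"
    define j where "j = p + k - n - 1"
    have j: "p + k - n = Suc j" "real p + \<beta> - real n = \<beta> - real k + real (Suc j)"
      using p assms(3) by (auto simp: j_def of_nat_diff)
    show "pochhammer (\<beta> - real k) (Suc (p + k - n - 1)) / fact (Suc (p + k - n - 1))
        = Gamma (real p + \<beta> - real n) / (Gamma (\<beta> - real k) * fact (p + k - n))"
      unfolding j j_def[symmetric] Gamma_shift_ratio[OF assms(1,2), symmetric] by simp
  qed (use assms in auto)
  then show ?thesis
    unfolding coeff_A_def sum.atMost_shift by simp
qed

text \<open>Pure algebra: \<open>I k p\<close> stands for the moment of degree p of the k-th
  iterated derivative, \<open>y k\<close> and \<open>z k\<close> for its values at a and t. Each
  integration by parts produces one A-term and cancels one Taylor term; after all orders k = n, ...,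
  0 only moments of the function itself remain, and these are the B-terms.\<close>

lemma moment_expansion:
  fixes L \<beta> :: real and I :: "nat \<Rightarrow> nat \<Rightarrow> real" and y z :: "nat \<Rightarrow> real"
  assumes "L > 0" "0 < \<beta>" "\<beta> < 1"
    and I0: "\<And>k. k \<le> n \<Longrightarrow> I (Suc k) 0 = z k - y k"
    and ISuc: "\<And>k p. k \<le> n \<Longrightarrow> I (Suc k) (Suc p) = L ^ Suc p * z k - real (Suc p) * I k p"
  shows "(\<Sum>k\<le>n. y k * L powr (real k - \<beta>) / Gamma (real k + 1 - \<beta>))
      + L powr (real n - \<beta>) / Gamma (real n + 1 - \<beta>)
        * (\<Sum>p\<le>M + n. pochhammer (\<beta> - real n) p / fact p / L ^ p * I (Suc n) p)
    = (\<Sum>k\<le>n. coeff_A n (M + n) \<beta> k * L powr (real k - \<beta>) * z k)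
      + (\<Sum>k = n + 1..M + n. coeff_B n \<beta> k * L powr (real n - \<beta> - real k)
          * (real (k - n) * I 0 (k - n - 1)))"
proof -
  define G where "G = (\<lambda>k. L powr (real k - \<beta>) / Gamma (real k + 1 - \<beta>))"
  define C where "C = (\<lambda>k. \<Sum>j\<le>M + k. pochhammer (\<beta> - real k) j / fact j)"
  define R where "R = (\<lambda>k. G k
    * (\<Sum>p\<le>M + k. pochhammer (\<beta> - real k) p / fact p / L ^ p * I (Suc k) p))"
  define Q where "Q = (\<lambda>k. - G k
    * (\<Sum>p<M + k. pochhammer (\<beta> - real k) (Suc p) / fact p / L ^ Suc p * I k p))"
  \<comment> \<open>Integrating \<open>R k\<close> by parts leaves \<open>Q k\<close>, which is \<open>R (k - 1)\<close>: the upper index \<open>M + k\<close> drops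
    by one together with the order of the derivative.\<close>
  have R: "R k = G k * (C k * z k - y k) + Q k" if k: "k \<le> n" for k
  proof -
    have "pochhammer (\<beta> - real k) (Suc p) / fact (Suc p) / L ^ Suc p * I (Suc k) (Suc p)
       = pochhammer (\<beta> - real k) (Suc p) / fact (Suc p) * z k
         - pochhammer (\<beta> - real k) (Suc p) / fact p / L ^ Suc p * I k p" for p
    proof -
      have "real (Suc p) / fact (Suc p) = 1 / (fact p :: real)" by (simp add: divide_simps)
      then show ?thesis
        unfolding ISuc[OF k] using assms(1)
        by (simp add: algebra_simps del: of_nat_Suc fact_Suc pochhammer_Suc power_Suc)
          (simp add: divide_simps del: pochhammer_Suc)
    qed
    then have "(\<Sum>p\<le>M + k. pochhammer (\<beta> - real k) p / fact p / L ^ p * I (Suc k) p)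
      = C k * z k - y k
        - (\<Sum>p<M + k. pochhammer (\<beta> - real k) (Suc p) / fact p / L ^ Suc p * I k p)"
      unfolding C_def sum.atMost_shift
      by (simp add: I0[OF k] sum_subtractf sum_distrib_right distrib_right del: fact_Suc pochhammer_Suc power_Suc)
    then show ?thesis unfolding R_def Q_def by (simp only: right_diff_distrib)
  qed
  have Q: "Q (Suc k) = R k" for k
  proof -
    have G: "G (Suc k) * (\<beta> - real (Suc k)) / L = - G k"
    proof -
      have "L powr (real (Suc k) - \<beta>) = L powr (real k - \<beta>) * L"
        using powr_add[of L "real k - \<beta>" 1] assms by (simp add: algebra_simps)
      moreover have "real (Suc k) - \<beta> \<noteq> 0" using assms by simp
      ultimately show ?thesis
        unfolding G_def Gamma_Suc_shift[OF assms(2,3)] using assms(1)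
        by (simp add: divide_simps del: of_nat_Suc) (simp add: algebra_simps)
    qed
    \<comment> \<open>Splitting off the first factor shifts the parameter from order Suc k to order
      k; that factor is what \<open>G\<close> absorbs.\<close>
    have poch: "pochhammer (\<beta> - real (Suc k)) (Suc p) = (\<beta> - real (Suc k)) * pochhammer (\<beta> - real k) p" for p
      unfolding pochhammer_rec by simp
    have "Q (Suc k) = - (\<Sum>p\<le>M + k. (G (Suc k) * (\<beta> - real (Suc k)) / L)
        * (pochhammer (\<beta> - real k) p / fact p / L ^ p * I (Suc k) p))"
      unfolding Q_def poch sum_distrib_left sum_negf[symmetric]
      by (simp add: lessThan_Suc_atMost mult_ac)
    then show ?thesis
      unfolding G R_def by (simp add: sum_distrib_left sum_negf)
  qed
  \<comment> \<open>Adding up the relations for \<open>R\<close>: each \<open>Q (Suc m)\<close> is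
    the \<open>R m\<close> already accounted for, so only \<open>Q 0\<close> is left.\<close>
  have "(\<Sum>k\<le>m. y k * G k) + R m = (\<Sum>k\<le>m. G k * C k * z k) + Q 0" if "m \<le> n" for m
    using that
  proof (induction m)
    case 0
    then show ?case using R[of 0] by (simp add: algebra_simps)
  next
    case (Suc m)
    then show ?case using R[of "Suc m"] Q[of m] by (simp add: algebra_simps)
  qed
  then have main: "(\<Sum>k\<le>n. y k * G k) + R n = (\<Sum>k\<le>n. G k * C k * z k) + Q 0" by simp
  have A: "G k * C k * z k = coeff_A n (M + n) \<beta> k * L powr (real k - \<beta>) * z k" if "k \<le> n" for k
    unfolding coeff_A_eq[OF assms(2,3) that] G_def C_def by simp
  have "(\<Sum>k = n + 1..M + n. coeff_B n \<beta> k * L powr (real n - \<beta> - real k)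
          * (real (k - n) * I 0 (k - n - 1))) = Q 0"
  proof -
    \<comment> \<open>The sign comes from Gamma (- \<beta>) * Gamma (1 + \<beta>) = - Gamma (1 -
      \<beta>) * Gamma \<beta>, and the factor \<open>real (Suc p)\<close> cancels against the
      factorial.\<close>
    have B: "coeff_B n \<beta> (Suc p + n) * L powr (real n - \<beta> - real (Suc p + n))
        * (real (Suc p) * I 0 p) = - G 0 * (pochhammer \<beta> (Suc p) / fact p / L ^ Suc p * I 0 p)" for p
    proof -
      have ni: "- \<beta> \<notin> \<int>\<^sub>\<le>\<^sub>0" "\<beta> \<notin> \<int>\<^sub>\<le>\<^sub>0"
        using fraction_minus_nat_notin_Ints[OF assms(2,3), of 0] nonpos_Ints_Int by fastforce+
      have "Gamma (1 - \<beta>) = - \<beta> * Gamma (- \<beta>)" "Gamma (1 + \<beta>) = \<beta> * Gamma \<beta>"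
        using Gamma_plus1[OF ni(1)] Gamma_plus1[OF ni(2)] by (simp_all add: add.commute)
      moreover have "Gamma (real (Suc p + n) + \<beta> - real n) = Gamma \<beta> * pochhammer \<beta> (Suc p)"
        using pochhammer_Gamma[OF ni(2), of "Suc p"] Gamma_eq_zero_iff[of \<beta>] ni
        by (simp add: field_simps del: pochhammer_Suc)
      moreover have "L powr (real n - \<beta> - real (Suc p + n)) = L powr (- \<beta>) / L ^ Suc p"
      proof -
        have "real n - \<beta> - real (Suc p + n) = - \<beta> - real (Suc p)" by simp
        then show ?thesis by (simp only: powr_diff powr_realpow[OF assms(1)])
      qed
      moreover have "Gamma \<beta> \<noteq> 0" "Gamma (- \<beta>) \<noteq> 0" using ni by (auto simp: Gamma_eq_zero_iff)
      moreover have "(fact (Suc p) :: real) = real (Suc p) * fact p" by simp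
      ultimately show ?thesis
        unfolding coeff_B_def G_def using assms
        by (simp add: divide_simps del: pochhammer_Suc fact_Suc power_Suc of_nat_Suc)
    qed
    have "(\<Sum>k = n + 1..M + n. coeff_B n \<beta> k * L powr (real n - \<beta> - real k)
          * (real (k - n) * I 0 (k - n - 1)))
      = (\<Sum>p<M. - G 0 * (pochhammer \<beta> (Suc p) / fact p / L ^ Suc p * I 0 p))"
    proof (rule sum.reindex_bij_witness[where i = "\<lambda>p. Suc p + n" and j = "\<lambda>k. k - n - 1"])
      fix k assume "k \<in> {n + 1..M + n}"
      then have k: "k = Suc (k - n - 1) + n" "k - n = Suc (k - n - 1)" by auto
      show "- G 0 * (pochhammer \<beta> (Suc (k - n - 1)) / fact (k - n - 1) / L ^ Suc (k - n - 1) * I 0 (k - n - 1))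
          = coeff_B n \<beta> k * L powr (real n - \<beta> - real k) * (real (k - n) * I 0 (k - n - 1))"
        using B[of "k - n - 1"] unfolding k(1)[symmetric] unfolding k(2)[symmetric] by (rule sym)
    qed auto
    then show ?thesis unfolding Q_def by (simp add: sum_distrib_left)
  qed
  moreover have "(\<Sum>k\<le>n. G k * C k * z k)
      = (\<Sum>k\<le>n. coeff_A n (M + n) \<beta> k * L powr (real k - \<beta>) * z k)"
    by (rule sum.cong) (simp_all only: A atMost_iff)
  ultimately show ?thesis using main unfolding R_def by (simp add: G_def)
qed

section \<open>Assembly of the expansion and the error estimate\<close>

theorem theorem3p4:
  fixes a b :: real and \<alpha> x :: "real \<Rightarrow> real" and n N :: nat
  assumes "0 < a" and "a < b"
    and "Ck_on 1 {a..b} \<alpha>" and "\<forall>t\<in>{a..b}. 0 < \<alpha> t \<and> \<alpha> t < 1"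
    and "n \<ge> 1" and "N \<ge> n + 1"
    and "Ck_on (n + 1) {a..b} x"
  shows "\<exists>E :: real \<Rightarrow> real. \<forall>t\<in>{a<..b}.
           hadamard_marchaud a \<alpha> x t = S1_approx a b n N \<alpha> x t + E t \<and>
           \<bar>E t\<bar> \<le> error_bound a b n N \<alpha> x t"
proof (intro exI ballI conjI)
  fix t assume t: "t \<in> {a<..b}"
  define \<beta> where "\<beta> = \<alpha> t"
  have \<beta>: "0 < \<beta>" "\<beta> < 1" using assms(4) t by (auto simp: \<beta>_def)
  define q where "q = real n - \<beta>"
  have q: "real n - 1 < q" "0 < q" "q \<le> real n" using \<beta> assms by (auto simp: q_def)
  define X where "X = x_seq0 {a..b} x"
  define L where "L = ln (t / a)"
  have L: "0 < L" using t assms by (simp add: L_def)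
  have sub: "{a..t} \<subseteq> {a..b}" and at: "a < t" using t by auto
  have Ck: "Ck_on k {a..b} x" if "k \<le> Suc n" for k
    using that
  proof (induction k rule: inc_induct)
    case base
    then show ?case using assms by simp
  qed (rule Ck_on_SucD)
  have der: "(X k has_real_derivative X (Suc k) \<tau> / \<tau>) (at \<tau> within {a..t})"
    if "k \<le> n" "\<tau> \<in> {a..t}" for k \<tau>
    unfolding X_def
    by (rule DERIV_subset[OF x_seq0_has_real_derivative sub]) (use assms Ck[of "Suc k"] that t in auto)
  have cont: "continuous_on {a..t} (X k)" if "k \<le> Suc n" for k
    unfolding X_def
    by (rule continuous_on_subset[OF continuous_on_x_seq0 sub]) (use assms Ck that in auto)
  define I where "I = (\<lambda>k p. integral {a..t} (\<lambda>\<tau>. ln (\<tau> / a) ^ p * (X k \<tau> / \<tau>)))"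
  define P where "P = (\<lambda>s. \<Sum>p\<le>N. (q gchoose p) * (- s) ^ p)"
  define K where "K = exp (q\<^sup>2 + q) / (q * real N powr q)"
  \<comment> \<open>With s = ln (\<tau> / a) / L one has ln (t / \<tau>) = L * (1 - s), so this is L
    powr q times the binomial remainder beyond degree N, which \<open>K\<close> bounds.\<close>
  define rem where "rem = (\<lambda>\<tau>. ln (t / \<tau>) powr q - L powr q * P (ln (\<tau> / a) / L))"
  define M where "M = (SUP \<tau>\<in>{a..t}. \<bar>x_seq1 {a..b} x n \<tau>\<bar>)"
  have x1: "x_seq1 {a..b} x n \<tau> = X (Suc n) \<tau> / \<tau>" if "\<tau> \<in> {a..t}" for \<tau>
    using x_seq1_eq_x_seq0 assms that sub unfolding X_def by blast
  have contd: "continuous_on {a..t} (\<lambda>\<tau>. X (Suc n) \<tau> / \<tau>)"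
    using assms by (intro continuous_intros cont) auto
  have leM: "\<bar>X (Suc n) \<tau> / \<tau>\<bar> \<le> M" if "\<tau> \<in> {a..t}" for \<tau>
  proof -
    \<comment> \<open>Continuity on the compact interval makes the supremum a genuine upper
      bound.\<close>
    have "bdd_above ((\<lambda>\<tau>. \<bar>X (Suc n) \<tau> / \<tau>\<bar>) ` {a..t})"
      by (intro bounded_imp_bdd_above compact_imp_bounded compact_continuous_image
          continuous_on_rabs contd compact_Icc)
    then have "\<bar>X (Suc n) \<tau> / \<tau>\<bar> \<le> (SUP \<tau>\<in>{a..t}. \<bar>X (Suc n) \<tau> / \<tau>\<bar>)"
      using that by (intro cSUP_upper)
    also have "\<dots> = M" unfolding M_def using x1 by (intro SUP_cong) auto
    finally show ?thesis .
  qed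
  have rem_le: "\<bar>rem \<tau>\<bar> \<le> L powr q * K" if \<tau>: "\<tau> \<in> {a..t}" for \<tau>
  proof -
    define s where "s = ln (\<tau> / a) / L"
    have s: "s \<in> {0..1}" using \<tau> t assms L by (auto simp: s_def L_def divide_right_mono)
    have "L * s = ln (\<tau> / a)" using L by (simp add: s_def)
    moreover have "ln (t / \<tau>) = L - ln (\<tau> / a)"
      using \<tau> t assms by (simp add: L_def ln_div)
    ultimately have "ln (t / \<tau>) = L * (1 - s)"
      by (simp add: right_diff_distrib)
    then have "ln (t / \<tau>) powr q = L powr q * (1 - s) powr q"
      by (simp add: powr_mult)
    then have "rem \<tau> = L powr q * ((1 - s) powr q - P s)"
      by (simp add: rem_def s_def algebra_simps)
    then have "\<bar>rem \<tau>\<bar> = L powr q * \<bar>(1 - s) powr q - P s\<bar>"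
      by (simp add: abs_mult)
    also have "\<dots> \<le> L powr q * K"
      unfolding P_def K_def
      by (intro mult_left_mono binomial_series_remainder_le_Icc[of n]) (use q s assms in auto)
    finally show ?thesis .
  qed
  have contP: "continuous_on {a..t} (\<lambda>\<tau>. L powr q * P (ln (\<tau> / a) / L) * (X (Suc n) \<tau> / \<tau>))"
    unfolding P_def using assms L by (intro continuous_intros cont) auto
  have contr: "continuous_on {a..t} (\<lambda>\<tau>. rem \<tau> * (X (Suc n) \<tau> / \<tau>))"
    unfolding rem_def P_def using assms L q
    by (intro continuous_intros continuous_on_powr' cont) auto
  \<comment> \<open>The part of the Taylor remainder that the truncated series misses.\<close>
  define e where "e = 1 / Gamma (q + 1) * integral {a..t} (\<lambda>\<tau>. rem \<tau> * (X (Suc n) \<tau> / \<tau>))"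
  have Gq: "Gamma (q + 1) > 0" using q by (intro Gamma_real_pos) auto
  have intP: "integral {a..t} (\<lambda>\<tau>. L powr q * P (ln (\<tau> / a) / L) * (X (Suc n) \<tau> / \<tau>))
      = L powr q * (\<Sum>p\<le>N. pochhammer (\<beta> - real n) p / fact p / L ^ p * I (Suc n) p)"
  proof -
    \<comment> \<open>The sign (-1) ^ p from the argument cancels the one relating
      \<open>q gchoose p\<close> to the pochhammer symbol at - q = \<beta> - n.\<close>
    have coeff: "(q gchoose p) * (- u / L) ^ p = pochhammer (\<beta> - real n) p / fact p / L ^ p * u ^ p" for p u
    proof -
      have "(- u / L) ^ p = (- 1) ^ p * (u ^ p / L ^ p)"
        using power_minus[of "u / L" p] by (simp add: power_divide)
      then have "(q gchoose p) * (- u / L) ^ p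
          = ((- 1) ^ p * (- 1) ^ p) * (pochhammer (- q) p / fact p * (u ^ p / L ^ p))"
        by (simp add: gbinomial_pochhammer)
      also have "(- 1) ^ p * (- 1) ^ p = (1 :: real)"
        by (simp flip: power_mult_distrib)
      finally show ?thesis by (simp add: q_def)
    qed
    have "integral {a..t} (\<lambda>\<tau>. L powr q * P (ln (\<tau> / a) / L) * (X (Suc n) \<tau> / \<tau>))
      = integral {a..t} (\<lambda>\<tau>. L powr q * (\<Sum>p\<le>N. pochhammer (\<beta> - real n) p / fact p / L ^ p
          * (ln (\<tau> / a) ^ p * (X (Suc n) \<tau> / \<tau>))))"
      unfolding P_def minus_divide_left coeff by (simp only: sum_distrib_right mult.assoc)
    also have "\<dots> = L powr q * (\<Sum>p\<le>N. pochhammer (\<beta> - real n) p / fact p / L ^ p * I (Suc n) p)"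
    proof -
      have "(\<lambda>\<tau>. pochhammer (\<beta> - real n) p / fact p / L ^ p
          * (ln (\<tau> / a) ^ p * (X (Suc n) \<tau> / \<tau>))) integrable_on {a..t}" for p
        using assms L by (intro integrable_continuous_interval continuous_intros cont) auto
      then show ?thesis
        unfolding I_def by (simp only: integral_mult_right integral_sum finite_atMost)
    qed
    finally show ?thesis .
  qed
  have "integral {a..t} (\<lambda>\<tau>. ln (t / \<tau>) powr q * (X (Suc n) \<tau> / \<tau>))
      = integral {a..t} (\<lambda>\<tau>. L powr q * P (ln (\<tau> / a) / L) * (X (Suc n) \<tau> / \<tau>)
          + rem \<tau> * (X (Suc n) \<tau> / \<tau>))"
    by (simp add: rem_def algebra_simps)
  also have "\<dots> = L powr q * (\<Sum>p\<le>N. pochhammer (\<beta> - real n) p / fact p / L ^ p * I (Suc n) p)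
      + Gamma (q + 1) * e"
    unfolding intP[symmetric] e_def using Gq contP contr
    by (simp add: integral_add integrable_continuous_interval)
  finally have split: "integral {a..t} (\<lambda>\<tau>. ln (t / \<tau>) powr q * (X (Suc n) \<tau> / \<tau>)) = \<dots>" .
  have x0: "x = X 0" by (auto simp: X_def)
  have N: "N = (N - n) + n" using assms by simp
  have "hadamard_marchaud a \<alpha> x t =
      (\<Sum>k\<le>n. X k a * L powr (real k - \<beta>) / Gamma (real k + 1 - \<beta>))
      + 1 / Gamma (real n + 1 - \<beta>) * integral {a..t} (\<lambda>\<tau>. ln (t / \<tau>) powr q * (X (Suc n) \<tau> / \<tau>))"
    unfolding x0 L_def \<beta>_def q_def
    by (rule hadamard_marchaud_taylor) (use assms at \<beta> der cont in \<open>auto simp: \<beta>_def\<close>)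
  also have "\<dots> = ((\<Sum>k\<le>n. X k a * L powr (real k - \<beta>) / Gamma (real k + 1 - \<beta>))
      + L powr (real n - \<beta>) / Gamma (real n + 1 - \<beta>)
        * (\<Sum>p\<le>(N - n) + n. pochhammer (\<beta> - real n) p / fact p / L ^ p * I (Suc n) p)) + e"
    unfolding split using Gq N by (simp add: q_def algebra_simps add_divide_distrib)
  also have "\<dots> = ((\<Sum>k\<le>n. coeff_A n (N - n + n) \<beta> k * L powr (real k - \<beta>) * X k t)
      + (\<Sum>k = n + 1..N - n + n. coeff_B n \<beta> k * L powr (real n - \<beta> - real k)
          * (real (k - n) * I 0 (k - n - 1)))) + e"
  proof (subst moment_expansion)
    show "I (Suc k) 0 = X k t - X k a" if "k \<le> n" for k
      unfolding I_def by (rule log_moment_by_parts) (use assms at der cont that in auto)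
    show "I (Suc k) (Suc p) = L ^ Suc p * X k t - real (Suc p) * I k p" if "k \<le> n" for k p
      unfolding I_def L_def by (rule log_moment_by_parts) (use assms at der cont that in auto)
  qed (use L \<beta> in auto)
  also have "\<dots> = S1_approx a b n N \<alpha> x t + e"
    unfolding S1_approx_def left_moment_def N[symmetric] I_def L_def \<beta>_def X_def
    by (simp add: atLeast0AtMost)
  finally have main: "hadamard_marchaud a \<alpha> x t = S1_approx a b n N \<alpha> x t + e" .
  have "0 \<le> K" using q by (simp add: K_def)
  have "norm (rem \<tau> * (X (Suc n) \<tau> / \<tau>)) \<le> L powr q * K * M" if "\<tau> \<in> {a..t}" for \<tau>
    unfolding real_norm_def abs_mult
    by (intro mult_mono rem_le leM that) (use \<open>0 \<le> K\<close> in auto)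
  \<comment> \<open>The factor 1 / \<tau> is already absorbed into the function bounded by
    \<open>M\<close>, so integrating in \<tau> gives the length t - a rather than L.\<close>
  then have "norm (integral {a..t} (\<lambda>\<tau>. rem \<tau> * (X (Suc n) \<tau> / \<tau>))) \<le> L powr q * K * M * (t - a)"
    using at by (intro integral_bound contr) auto
  then have "\<bar>e\<bar> \<le> 1 / Gamma (q + 1) * (L powr q * K * M * (t - a))"
    unfolding e_def abs_mult using Gq by (intro mult_mono) auto
  also have "\<dots> = error_bound a b n N \<alpha> x t"
  proof -
    have "real n - \<alpha> t = q" "real n + 1 - \<alpha> t = q + 1" "q\<^sup>2 + real n - \<alpha> t = q\<^sup>2 + q"
      by (simp_all add: q_def \<beta>_def)
    then have "error_bound a b n N \<alpha> x t
        = M * (exp (q\<^sup>2 + q) / (Gamma (q + 1) * q * real N powr q)) * L powr q * (t - a)"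
      unfolding error_bound_def M_def[symmetric] L_def[symmetric] by (simp only:)
    then show ?thesis by (simp add: K_def mult_ac)
  qed
  finally have "\<bar>e\<bar> \<le> error_bound a b n N \<alpha> x t" .
  \<comment> \<open>The witness for E is the plain difference, equal to \<open>e\<close> at the
    given t; the content lies in the bound.\<close>
  with main show "hadamard_marchaud a \<alpha> x t = S1_approx a b n N \<alpha> x t
      + (\<lambda>t. hadamard_marchaud a \<alpha> x t - S1_approx a b n N \<alpha> x t) t"
    and "\<bar>(\<lambda>t. hadamard_marchaud a \<alpha> x t - S1_approx a b n N \<alpha> x t) t\<bar> \<le> error_bound a b n N \<alpha> x t"
    by simp_all
qed

end
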